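(* Consider the forest fire model on $\mathbb{Z}_+$ with instant spread ($\Delta\equiv0$) and constant burning time $\theta>0$. Assume that the following holds: there is a constant $c\ge 1$ such that almost surely there exists a (possibly random) $\kappa$ with $$f_{m_i,2}\le c\log m_i\quad\text{for all } i\ge\kappa .$$ Then $f_{n,1}=\mathcal{O}(\log n)$ almost surely, i.e. there exists $M>0$ such that, almost surely, $f_{n,1}\le M\log n$ for all large $n$.
   Context: Forest fire model with instant spread and constant burning time $\theta>0$ on $\mathbb{Z}_+=\{0,1,2,\dots\}$. Each site is vacant, occupied by a non-burning tree, or occupied by a burning tree; all sites are vacant at time $0$. At each vacant site a tree appears after an $\exp(1)$ time, independently of everything else. There is a constant source of fire at site $0$: a tree appearing at $0$ starts burning immediately. A tree that starts burning burns for a time $\theta$, after which its site becomes vacant. Let $f_{x,i}$ be the time when site $x$ starts burning for the $i$-th time. Spread: if at time $t=f_{x,i}$ there is a non-burning tree at $x+1$, it starts burning at time $t$. Otherwise, if the next tree at $x+1$ appears at time $t+\nu$, $\nu>0$, it starts burning immediately at time $t+\nu$ if $\nu<\theta$, while if $\nu\ge\theta$ this fire does not propagate beyond $x$. While a site is burning, no tree grows there and no fire can spread to it from the left. The $k$-th fire is the one started by the $k$-th burning of site $0$, together with all burnings successively ignited by it. Successive maxima: $m_1$ is the location of the farthest tree from the origin burnt by the first fire, and for $k\ge2$, $m_k$ is the location of the farthest tree from the origin burnt by the first fire which reaches beyond $m_{k-1}$ (with $m_k=\infty$ if that fire never stops or $m_{k-1}=\infty$; in this model all $m_k$ are a.s.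 finite). *)

theory Defs
  imports "HOL-Probability.Probability"
begin

text \<open>
  The model is built pathwise from waiting times: \<open>g x i\<close> is the time that site \<open>x\<close> stays vacant
  before its \<open>i\<close>-th tree appears. Trees, burnings and fires are numbered from 1.
\<close>

text \<open>
  Let \<open>F k\<close> be the starting time of the \<open>k\<close>-th burning of a site. A tree that appears at time \<open>a\<close> on
  the right neighbour can be ignited by the \<open>k\<close>-th burning if it is already standing at time \<open>F k\<close>, or
  if it appears at time \<open>F k + \<nu>\<close> with \<open>0 < \<nu> < \<theta>\<close>; it is ignited by the first such burning.
\<close>

definition igniter :: "real \<Rightarrow> (nat \<Rightarrow> real) \<Rightarrow> real \<Rightarrow> nat" where
  "igniter \<theta> F a = (LEAST k. 1 \<le> k \<and> (a \<le> F k \<or> (F k < a \<and> a < F k + \<theta>)))"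

text \<open>
  \<open>burn \<theta> g x i\<close> is \<open>f\<^bsub>x,i\<^esub>\<close>, the time when \<open>x\<close> starts burning for the \<open>i\<close>-th time (\<open>i \<ge> 1\<close>). The
  site becomes vacant again at time \<open>f\<^bsub>x,i\<^esub> + \<theta>\<close>; the convention \<open>f\<^bsub>x,0\<^esub> = - \<theta>\<close> makes every site vacant at
  time 0. In the last equation \<open>a\<close> is the time when the tree appears: it burns at once if its
  igniter is already burning, and otherwise as soon as the igniter starts burning.
\<close>

fun burn :: "real \<Rightarrow> (nat \<Rightarrow> nat \<Rightarrow> real) \<Rightarrow> nat \<Rightarrow> nat \<Rightarrow> real" where
  "burn \<theta> g x 0 = - \<theta>"
| "burn \<theta> g 0 (Suc i) = burn \<theta> g 0 i + \<theta> + g 0 (Suc i)"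
| "burn \<theta> g (Suc x) (Suc i) =
     (let a = burn \<theta> g (Suc x) i + \<theta> + g (Suc x) (Suc i)
      in max a (burn \<theta> g x (igniter \<theta> (\<lambda>k. burn \<theta> g x k) a)))"

definition tree_time :: "real \<Rightarrow> (nat \<Rightarrow> nat \<Rightarrow> real) \<Rightarrow> nat \<Rightarrow> nat \<Rightarrow> real" where
  "tree_time \<theta> g x i = burn \<theta> g x (i - 1) + \<theta> + g x i"

text \<open>The number of the fire to which the \<open>i\<close>-th burning of \<open>x\<close> belongs.\<close>

primrec fire_of :: "real \<Rightarrow> (nat \<Rightarrow> nat \<Rightarrow> real) \<Rightarrow> nat \<Rightarrow> nat \<Rightarrow> nat" where
  "fire_of \<theta> g 0 i = i"
| "fire_of \<theta> g (Suc x) i = fire_of \<theta> g x (igniter \<theta> (burn \<theta> g x) (tree_time \<theta> g (Suc x) i))"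

text \<open>The farthest site burnt by the \<open>k\<close>-th fire, \<open>\<infinity>\<close> if the fire never stops.\<close>

definition fire_extent :: "real \<Rightarrow> (nat \<Rightarrow> nat \<Rightarrow> real) \<Rightarrow> nat \<Rightarrow> enat" where
  "fire_extent \<theta> g k = (SUP x\<in>{x. \<exists>i\<ge>1. fire_of \<theta> g x i = k}. enat x)"

text \<open>The successive maxima \<open>m\<^sub>1, m\<^sub>2, \<dots>\<close>; the value at index 0 is a dummy.\<close>

fun succ_max :: "real \<Rightarrow> (nat \<Rightarrow> nat \<Rightarrow> real) \<Rightarrow> nat \<Rightarrow> enat" where
  "succ_max \<theta> g 0 = 0"
| "succ_max \<theta> g (Suc 0) = fire_extent \<theta> g 1"
| "succ_max \<theta> g (Suc (Suc k)) =
     (if succ_max \<theta> g (Suc k) = \<infinity> then \<infinity>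
      else fire_extent \<theta> g (LEAST l. 1 \<le> l \<and> succ_max \<theta> g (Suc k) < fire_extent \<theta> g l))"

end

theory Submission
  imports Defs
begin

text \<open>
  Call \<open>x\<close> a record site if its first burning is over before the first tree at \<open>x + 1\<close> appears; the
  record sites are exactly the finite successive maxima. If \<open>x\<close> is not a record site, then the first
  burning of \<open>x + 1\<close> happens at the maximum of the first burning time of \<open>x\<close> and the first waiting
  time at \<open>x + 1\<close>, which is eventually at most \<open>2 log x\<close>. So only record sites \<open>x\<close> can do harm, and
  there only if the first tree at \<open>x + 1\<close> is ignited by a \<open>k\<close>-th burning of \<open>x\<close> which comes very late,
  \<open>f\<^bsub>x,k\<^esub> > C log x\<close>, although the tree was there by time \<open>2 log x\<close>. By hypothesis \<open>k \<ge> 3\<close>.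

  Fix all waiting times at sites up to \<open>x\<close>. By lack of memory, this bad event is at most a constant
  times as likely as the event that the same tree is already ignited by the \<open>(k-1)\<close>-st burning of
  \<open>x\<close>. If the latter events occur finitely often, so do the bad ones, by an elementary first-passage
  argument replacing the conditional Borel--Cantelli lemma. And they do occur finitely often: when
  the \<open>(k-1)\<close>-st burning, at time at most \<open>2 log x\<close>, gets across \<open>x\<close>, all sites \<open>m > x\<close> have
  \<open>f\<^bsub>m,2\<^esub> \<ge> f\<^bsub>x,k\<^esub> > C log x\<close>, while almost surely a new record site \<open>m < x\<^sup>p\<close> appears, for which
  \<open>f\<^bsub>m,2\<^esub> \<le> c p log x\<close> by hypothesis.
\<close>

section \<open>Paths of the model and record sites\<close>

declare burn.simps(3) [simp del] fire_of.simps(2) [simp del]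

definition record_site :: "real \<Rightarrow> (nat \<Rightarrow> nat \<Rightarrow> real) \<Rightarrow> nat \<Rightarrow> bool" where
  "record_site \<theta> g x \<longleftrightarrow> burn \<theta> g x 1 + \<theta> \<le> g (Suc x) 1"

text \<open>The pathwise part of the argument is deterministic: positive waiting times are all it
  uses, and these hold almost surely (\<open>AE_fire_path\<close>).\<close>

locale fire_path =
  fixes \<theta> :: real and g :: "nat \<Rightarrow> nat \<Rightarrow> real"
  assumes theta_pos: "0 < \<theta>"
    and wait_pos: "1 \<le> i \<Longrightarrow> 0 < g x i"
begin

abbreviation b :: "nat \<Rightarrow> nat \<Rightarrow> real" where "b \<equiv> burn \<theta> g"

abbreviation ign :: "nat \<Rightarrow> nat \<Rightarrow> nat" where
  "ign x i \<equiv> igniter \<theta> (b x) (tree_time \<theta> g (Suc x) i)"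

lemma tree_time_Suc: "tree_time \<theta> g x (Suc i) = b x i + \<theta> + g x (Suc i)"
  by (simp add: tree_time_def)

lemma tree_time_first: "tree_time \<theta> g x 1 = g x 1"
  by (simp add: tree_time_def)

lemma burn_Suc_site: "1 \<le> i \<Longrightarrow> b (Suc x) i = max (tree_time \<theta> g (Suc x) i) (b x (ign x i))"
  by (cases i) (simp_all add: burn.simps(3) Let_def tree_time_def)

lemma tree_time_le_burn: "1 \<le> i \<Longrightarrow> tree_time \<theta> g x i \<le> b x i"
  by (cases x; cases i) (simp_all add: burn.simps(3) Let_def tree_time_def)

lemma burn_step: "b x i + \<theta> < b x (Suc i)"
  using tree_time_le_burn[of "Suc i" x] wait_pos[of "Suc i" x] by (simp add: tree_time_Suc)

lemma burn_gap: "i < j \<Longrightarrow> b x i + \<theta> < b x j"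
proof (induction j)
  case (Suc j)
  then show ?case
    using burn_step[of x j] theta_pos by (cases "i = j") auto
qed simp

lemma burn_less_iff: "b x i < b x j \<longleftrightarrow> i < j"
  using burn_gap[of i j x] burn_gap[of j i x] theta_pos by (cases i j rule: linorder_cases) auto

lemma burn_le_iff: "b x i \<le> b x j \<longleftrightarrow> i \<le> j"
  using burn_less_iff[of x j i] by (simp add: not_less[symmetric])

lemma burn_pos: "1 \<le> i \<Longrightarrow> 0 < b x i"
  using burn_gap[of 0 i x] by simp

lemma burn_ge_linear: "real i * \<theta> - \<theta> \<le> b x i"
proof (induction i)
  case (Suc i)
  then show ?case using burn_step[of x i] by (simp add: algebra_simps)
qed simp

text \<open>Burnings of a site are more than theta apart, so their times are unbounded and the
  \<open>LEAST\<close> in \<open>igniter\<close> is attained.\<close>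

lemma ign_exists: "\<exists>k. 1 \<le> k \<and> (a \<le> b x k \<or> (b x k < a \<and> a < b x k + \<theta>))"
proof -
  obtain n where n: "a < real n * \<theta>"
    using reals_Archimedean3[OF theta_pos] by blast
  have "a < b x (Suc n)"
    using burn_ge_linear[of "Suc n" x] n by (simp add: algebra_simps)
  then show ?thesis by (intro exI[of _ "Suc n"]) auto
qed

text \<open>As theta > 0, the two alternatives in \<open>igniter\<close> merge into
  \<open>a < F k + \<theta>\<close>; with \<open>igniter_le\<close>, the igniter is the first
  burning not yet over at time \<open>a\<close>.\<close>

lemma
  shows igniter_ge1: "1 \<le> igniter \<theta> (b x) a"
    and less_burn_igniter: "a < b x (igniter \<theta> (b x) a) + \<theta>"
  using LeastI_ex[OF ign_exists[of a x], folded igniter_def] theta_pos by auto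

lemma igniter_le: "1 \<le> k \<Longrightarrow> a < b x k + \<theta> \<Longrightarrow> igniter \<theta> (b x) a \<le> k"
  unfolding igniter_def by (rule Least_le) auto

text \<open>The next tree at \<open>x + 1\<close> appears only after the igniter of the previous one
  has gone out, so a strictly later burning of \<open>x\<close> has to ignite it.\<close>

lemma ign_less_ign:
  assumes "1 \<le> i"
  shows "ign x i < ign x (Suc i)"
proof -
  have "b x (ign x i) + \<theta> \<le> b (Suc x) i + \<theta>"
    using assms by (simp add: burn_Suc_site)
  also have "\<dots> < tree_time \<theta> g (Suc x) (Suc i)"
    using wait_pos[of "Suc i" "Suc x"] by (simp add: tree_time_Suc)
  also have "\<dots> < b x (ign x (Suc i)) + \<theta>"
    by (rule less_burn_igniter)
  finally show ?thesis
    by (simp add: burn_less_iff)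
qed

lemma le_ign: "1 \<le> i \<Longrightarrow> i \<le> ign x i"
proof (induction i rule: nat_induct_at_least)
  case base
  then show ?case by (rule igniter_ge1)
next
  case (Suc i)
  then show ?case using ign_less_ign[of i x] by simp
qed

lemma burn_le_next_site:
  assumes "1 \<le> i" shows "b x i \<le> b (Suc x) i"
  using burn_le_iff[of x i "ign x i"] le_ign[OF assms, of x] burn_Suc_site[OF assms, of x] by simp

lemma burn_mono_site:
  assumes "1 \<le> i" "x \<le> y" shows "b x i \<le> b y i"
  using assms(2) burn_le_next_site[OF assms(1)] by (rule lift_Suc_mono_le[rotated])

text \<open>The second tree at \<open>x + 1\<close> cannot reuse the igniter of the first. A long
  pause at \<open>x\<close> after that igniter therefore delays the second burning of
  \<open>x + 1\<close>.\<close>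

lemma second_burn_ge: "b x (Suc (ign x 1)) \<le> b (Suc x) 2"
proof -
  have "Suc (ign x 1) \<le> ign x 2"
    using ign_less_ign[of 1 x] by (simp add: numeral_2_eq_2)
  then show ?thesis
    using burn_Suc_site[of 2 x] burn_le_iff[of x "Suc (ign x 1)" "ign x 2"] by simp
qed

lemma first_burn_eq: "b (Suc x) 1 = max (g (Suc x) 1) (b x (ign x 1))"
  using burn_Suc_site[of 1 x] by (simp only: tree_time_first)

lemma record_site_iff: "record_site \<theta> g x \<longleftrightarrow> 1 < ign x 1"
proof (cases "g (Suc x) 1 < b x 1 + \<theta>")
  case True
  then have "ign x 1 \<le> 1"
    by (intro igniter_le) (simp_all only: tree_time_first)
  then show ?thesis
    using True by (simp add: record_site_def)
next
  case False
  then have "ign x 1 \<noteq> 1"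
    using less_burn_igniter[of "tree_time \<theta> g (Suc x) 1" x] by (metis tree_time_first)
  then show ?thesis
    using False igniter_ge1[of x "tree_time \<theta> g (Suc x) 1"] by (simp add: record_site_def)
qed

lemma first_burn_not_record: "\<not> record_site \<theta> g x \<Longrightarrow> b (Suc x) 1 = max (g (Suc x) 1) (b x 1)"
  using igniter_ge1[of x "tree_time \<theta> g (Suc x) 1"] first_burn_eq[of x]
  by (metis record_site_iff antisym not_less)

section \<open>Numbers of fires, and record sites as successive maxima\<close>

lemma fire_of_less: "1 \<le> i \<Longrightarrow> i < j \<Longrightarrow> fire_of \<theta> g x i < fire_of \<theta> g x j"
proof (induction x arbitrary: i j)
  case (Suc x)
  \<comment> \<open>The igniter map is strictly increasing; following it site by site down to 0
    keeps the order of burnings.\<close>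
  have "ign x i < ign x j"
    using Suc.prems(2,1)
  proof (induction j)
    case (Suc j)
    then show ?case
      using ign_less_ign[of j x] by (cases "i = j") auto
  qed simp
  then show ?case
    using Suc.IH igniter_ge1 by (simp add: fire_of.simps(2))
qed simp

lemma fire_of_le: "1 \<le> i \<Longrightarrow> i \<le> j \<Longrightarrow> fire_of \<theta> g x i \<le> fire_of \<theta> g x j"
  using fire_of_less[of i j x] by (cases "i = j") auto

abbreviation first_fire :: "nat \<Rightarrow> nat" where "first_fire x \<equiv> fire_of \<theta> g x 1"

lemma first_fire_step: "first_fire x \<le> first_fire (Suc x)"
  using fire_of_le[OF order_refl igniter_ge1] by (simp add: fire_of.simps(2))

lemma first_fire_mono: "x \<le> y \<Longrightarrow> first_fire x \<le> first_fire y"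
  by (rule lift_Suc_mono_le[of first_fire]) (rule first_fire_step)

lemma first_fire_ge1: "1 \<le> first_fire x"
  using first_fire_mono[of 0 x] by simp

lemma first_fire_record: "record_site \<theta> g x \<Longrightarrow> first_fire x < first_fire (Suc x)"
  using fire_of_less[of 1 "ign x 1" x] by (simp add: record_site_iff fire_of.simps(2))

lemma first_fire_not_record: "\<not> record_site \<theta> g x \<Longrightarrow> first_fire (Suc x) = first_fire x"
  using igniter_ge1[of x "tree_time \<theta> g (Suc x) 1"] by (simp add: record_site_iff fire_of.simps(2))

lemma first_fire_const:
  assumes "x \<le> y" and "\<And>z. x \<le> z \<Longrightarrow> z < y \<Longrightarrow> \<not> record_site \<theta> g z"
  shows "first_fire y = first_fire x"
  using assms
proof (induction y rule: dec_induct)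
  case (step y)
  then show ?case
    using first_fire_not_record[of y] by simp
qed simp

lemma fire_reaches_imp: "1 \<le> i \<Longrightarrow> fire_of \<theta> g y i = l \<Longrightarrow> z \<le> y \<Longrightarrow> first_fire z \<le> l"
  using fire_of_le[of 1 i y] first_fire_mono[of z y] by simp

text \<open>This fire burns \<open>x\<close>, while the first fire to reach \<open>x + 1\<close>
  already has a larger number.\<close>

lemma fire_extent_record:
  assumes "record_site \<theta> g x"
  shows "fire_extent \<theta> g (first_fire x) = enat x"
  unfolding fire_extent_def
proof (rule antisym)
  show "(SUP y\<in>{y. \<exists>i\<ge>1. fire_of \<theta> g y i = first_fire x}. enat y) \<le> enat x"
  proof (rule SUP_least, clarify)
    fix y i :: nat assume "1 \<le> i" "fire_of \<theta> g y i = first_fire x"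
    then have "\<not> Suc x \<le> y"
      using fire_reaches_imp[of i y "first_fire x" "Suc x"] first_fire_record[OF assms] by linarith
    then show "enat y \<le> enat x" by simp
  qed
  show "enat x \<le> (SUP y\<in>{y. \<exists>i\<ge>1. fire_of \<theta> g y i = first_fire x}. enat y)"
    by (rule SUP_upper) auto
qed

text \<open>Identifies the \<open>LEAST\<close> in \<open>succ_max\<close>: a fire passing
  \<open>x\<close> burns some site from \<open>x + 1\<close> on, so it is no earlier than the first
  fire at \<open>x + 1\<close>.\<close>

lemma first_fire_beyond:
  "(LEAST l. 1 \<le> l \<and> enat x < fire_extent \<theta> g l) = first_fire (Suc x)"
proof (rule Least_equality)
  have "enat (Suc x) \<le> fire_extent \<theta> g (first_fire (Suc x))"
    unfolding fire_extent_def by (rule SUP_upper) auto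
  then show "1 \<le> first_fire (Suc x) \<and> enat x < fire_extent \<theta> g (first_fire (Suc x))"
    using first_fire_ge1[of "Suc x"] less_le_trans[of "enat x" "enat (Suc x)"] by simp
next
  fix l assume "1 \<le> l \<and> enat x < fire_extent \<theta> g l"
  then obtain y i where "x < y" "1 \<le> i" "fire_of \<theta> g y i = l"
    unfolding fire_extent_def less_SUP_iff by auto
  then show "first_fire (Suc x) \<le> l"
    using fire_reaches_imp[of i y l "Suc x"] by simp
qed

text \<open>Induction along record sites. From the site after the previous record site
  \<open>y\<close> up to \<open>x\<close> the number of the first fire is constant, so the fire that
  first passes \<open>y\<close> is the one that stops at \<open>x\<close>.\<close>

lemma record_site_succ_max:
  assumes "record_site \<theta> g x"
  shows "succ_max \<theta> g (card {y. y \<le> x \<and> record_site \<theta> g y}) = enat x"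
  using assms
proof (induction x rule: less_induct)
  case (less x)
  show ?case
  proof (cases "\<exists>y<x. record_site \<theta> g y")
    case False
    then have "{y. y \<le> x \<and> record_site \<theta> g y} = {x}"
      using less.prems by (auto simp: le_less)
    moreover have "first_fire x = 1"
      using first_fire_const[of 0 x] False by simp
    ultimately show ?thesis
      using fire_extent_record[OF less.prems] by simp
  next
    case True
    define y where "y = Max {y. y < x \<and> record_site \<theta> g y}"
    have fin: "finite {y. y < x \<and> record_site \<theta> g y}" by simp
    have "y \<in> {y. y < x \<and> record_site \<theta> g y}"
      unfolding y_def by (rule Max_in[OF fin]) (use True in auto)
    then have y: "y < x" "record_site \<theta> g y" by auto
    have max: "z \<le> y" if "z < x" "record_site \<theta> g z" for z
      unfolding y_def by (rule Max_ge[OF fin]) (use that in auto)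
    have "{z. z \<le> x \<and> record_site \<theta> g z} = insert x {z. z \<le> y \<and> record_site \<theta> g z}"
      using y less.prems max by (auto simp: le_less)
    then have card: "card {z. z \<le> x \<and> record_site \<theta> g z} = Suc (card {z. z \<le> y \<and> record_site \<theta> g z})"
      using y by simp
    obtain k where k: "card {z. z \<le> y \<and> record_site \<theta> g z} = Suc k"
      using y by (cases "card {z. z \<le> y \<and> record_site \<theta> g z}") auto
    have "first_fire x = first_fire (Suc y)"
      using y max by (intro first_fire_const) fastforce+
    then show ?thesis
      using less.IH[OF y] fire_extent_record[OF less.prems] first_fire_beyond[of y] card k
      by simp
  qed
qed

text \<open>Turns a bound for all large indices into one for all far record sites: either there are
  finitely many record sites, or a far one has at least \<open>\<kappa>\<close> of them up to
  it.\<close>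

lemma eventually_record_succ_max:
  "\<forall>\<^sub>F x in sequentially. record_site \<theta> g x \<longrightarrow> (\<exists>i\<ge>\<kappa>. succ_max \<theta> g i = enat x)"
proof (cases "finite {x. record_site \<theta> g x}")
  case True
  then obtain N where "\<And>x. record_site \<theta> g x \<Longrightarrow> x < N"
    using finite_nat_bounded[OF True] by auto
  then show ?thesis
    unfolding eventually_sequentially by (intro exI[of _ N]) force
next
  case False
  then obtain A where A: "A \<subseteq> {x. record_site \<theta> g x}" "finite A" "card A = \<kappa>"
    using infinite_arbitrarily_large by blast
  then obtain N where N: "A \<subseteq> {..<N}"
    using finite_nat_bounded by blast
  show ?thesis
  proof (intro eventually_sequentiallyI[of N] impI)
    fix x assume x: "N \<le> x" "record_site \<theta> g x"
    have "card A \<le> card {y. y \<le> x \<and> record_site \<theta> g y}"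
      using A N x by (intro card_mono) auto
    then show "\<exists>i\<ge>\<kappa>. succ_max \<theta> g i = enat x"
      using record_site_succ_max[OF x(2)] A(3) by auto
  qed
qed

end

section \<open>Borel--Cantelli arguments\<close>

text \<open>The sets \<open>B (N + i) - (\<Union>j<i. B (N + j))\<close> are disjoint, so their probabilities are summable.\<close>

lemma (in prob_space) AE_finitely_often_transfer:
  fixes A B :: "nat \<Rightarrow> 'a set"
  assumes A: "\<And>x. A x \<in> events" and B: "\<And>x. B x \<in> events"
    and le: "\<And>N i. prob (A (N + i) - (\<Union>j<i. B (N + j))) \<le> \<kappa> * prob (B (N + i) - (\<Union>j<i. B (N + j)))"
  shows "AE \<omega> in M. (\<forall>\<^sub>F x in sequentially. \<omega> \<notin> B x) \<longrightarrow> (\<forall>\<^sub>F x in sequentially. \<omega> \<notin> A x)"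
proof -
  have "AE \<omega> in M. \<forall>N. \<forall>\<^sub>F i in sequentially. \<omega> \<in> space M - (A (N + i) - (\<Union>j<i. B (N + j)))"
    unfolding AE_all_countable
  proof
    fix N
    have eq: "disjointed (\<lambda>i. B (N + i)) = (\<lambda>i. B (N + i) - (\<Union>j<i. B (N + j)))"
      by (simp add: disjointed_def fun_eq_iff atLeast0LessThan)
    have "(\<lambda>i. prob (disjointed (\<lambda>i. B (N + i)) i)) sums prob (\<Union>i. disjointed (\<lambda>i. B (N + i)) i)"
      using B by (intro finite_measure_UNION disjoint_family_disjointed) (auto simp: eq)
    then have "summable (\<lambda>i. \<kappa> * prob (B (N + i) - (\<Union>j<i. B (N + j))))"
      unfolding eq by (intro summable_mult) (rule sums_summable)
    then have "summable (\<lambda>i. prob (A (N + i) - (\<Union>j<i. B (N + j))))"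
      by (rule summable_comparison_test[rotated]) (use le in \<open>auto simp: measure_nonneg\<close>)
    then show "AE \<omega> in M. \<forall>\<^sub>F i in sequentially. \<omega> \<in> space M - (A (N + i) - (\<Union>j<i. B (N + j)))"
      using A B by (intro borel_cantelli_AE1) (auto simp: less_top[symmetric])
  qed
  then show ?thesis
  proof eventually_elim
    case (elim \<omega>)
    show ?case
    proof
      assume "\<forall>\<^sub>F x in sequentially. \<omega> \<notin> B x"
      \<comment> \<open>For this \<open>N\<close> the outcome lies in none of the subtracted sets,
        so the differences contain it exactly when \<open>A (N + i)\<close> does.\<close>
      then obtain N where N: "\<And>x. N \<le> x \<Longrightarrow> \<omega> \<notin> B x"
        unfolding eventually_sequentially by auto
      from elim have "\<forall>\<^sub>F i in sequentially. \<omega> \<in> space M - (A (N + i) - (\<Union>j<i. B (N + j)))" ..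
      then have "\<forall>\<^sub>F i in sequentially. \<omega> \<notin> A (i + N)"
        by eventually_elim (use N in \<open>auto simp: add.commute\<close>)
      then show "\<forall>\<^sub>F x in sequentially. \<omega> \<notin> A x"
        by (rule eventually_sequentially_seg[THEN iffD1])
    qed
  qed
qed

lemma (in prob_space) AE_finitely_often:
  assumes "\<And>n. {\<omega> \<in> space M. Q n \<omega>} \<in> events"
    and "\<forall>\<^sub>F n in sequentially. prob {\<omega> \<in> space M. Q n \<omega>} \<le> f n" and "summable f"
  shows "AE \<omega> in M. \<forall>\<^sub>F n in sequentially. \<not> Q n \<omega>"
proof -
  have "summable (\<lambda>n. prob {\<omega> \<in> space M. Q n \<omega>})"
    by (rule summable_comparison_test_ev[OF _ assms(3)]) (use assms(2) in \<open>auto elim: eventually_mono\<close>)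
  then have "AE \<omega> in M. \<forall>\<^sub>F n in sequentially. \<omega> \<in> space M - {\<omega> \<in> space M. Q n \<omega>}"
    using assms(1) by (intro borel_cantelli_AE1) (auto simp: less_top[symmetric])
  then show ?thesis
    by eventually_elim (auto elim: eventually_mono)
qed

section \<open>Dependence on the waiting times\<close>

text \<open>Fire travels only to the right. This makes the wait at \<open>x + 1\<close> independent
  of all burnings of \<open>x\<close>.\<close>

lemma burn_cong:
  assumes "\<And>y j. y \<le> x \<Longrightarrow> 1 \<le> j \<Longrightarrow> g y j = g' y j"
  shows "burn \<theta> g x i = burn \<theta> g' x i"
  using assms
proof (induction x arbitrary: i)
  case 0
  show ?case by (induction i) (simp_all add: 0)
next
  case (Suc x)
  have IH: "burn \<theta> g x = burn \<theta> g' x"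
    using Suc by (auto simp: fun_eq_iff)
  show ?case by (induction i) (simp_all add: burn.simps(3) Suc.prems IH)
qed

lemma measurable_burn:
  assumes [measurable]: "\<And>y j. y \<le> x \<Longrightarrow> 1 \<le> j \<Longrightarrow> (\<lambda>\<omega>. g y j \<omega>) \<in> borel_measurable M"
  shows "(\<lambda>\<omega>. burn \<theta> (\<lambda>y j. g y j \<omega>) x i) \<in> borel_measurable M"
  using assms
proof (induction x arbitrary: i)
  case 0
  note 0[measurable]
  show ?case
  proof (induction i)
    case (Suc i)
    note Suc[measurable]
    show ?case by simp
  qed simp
next
  case (Suc x)
  note Suc.prems[measurable]
  have [measurable]: "(\<lambda>\<omega>. burn \<theta> (\<lambda>y j. g y j \<omega>) x i) \<in> borel_measurable M" for i
    by (rule Suc.IH) (simp add: Suc.prems)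
  show ?case
  proof (induction i)
    case (Suc i)
    note Suc[measurable]
    define a where "a = (\<lambda>\<omega>. burn \<theta> (\<lambda>y j. g y j \<omega>) (Suc x) i + \<theta> + g (Suc x) (Suc i) \<omega>)"
    have [measurable]: "a \<in> borel_measurable M"
      unfolding a_def by measurable
    have "(\<lambda>\<omega>. igniter \<theta> (burn \<theta> (\<lambda>y j. g y j \<omega>) x) (a \<omega>)) \<in> measurable M (count_space UNIV)"
      unfolding igniter_def by measurable
    \<comment> \<open>The igniter is a random index with countably many values, so evaluating the
      burning times at it stays measurable.\<close>
    then have [measurable]: "(\<lambda>\<omega>. burn \<theta> (\<lambda>y j. g y j \<omega>) x
       (igniter \<theta> (burn \<theta> (\<lambda>y j. g y j \<omega>) x) (a \<omega>))) \<in> borel_measurable M"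
      by (rule measurable_compose_countable[rotated]) measurable
    have "(\<lambda>\<omega>. burn \<theta> (\<lambda>y j. g y j \<omega>) (Suc x) (Suc i)) = (\<lambda>\<omega>. max (a \<omega>)
       (burn \<theta> (\<lambda>y j. g y j \<omega>) x (igniter \<theta> (burn \<theta> (\<lambda>y j. g y j \<omega>) x) (a \<omega>))))"
      by (simp only: burn.simps Let_def a_def)
    then show ?case
      by simp
  qed simp
qed

section \<open>The exponential law\<close>

abbreviation Exp1 :: "real measure" where
  "Exp1 \<equiv> density lborel (exponential_density 1)"

interpretation Exp1: prob_space Exp1
  by (rule prob_space_exponential_density) simp

lemma Exp1_atLeast: "0 \<le> t \<Longrightarrow> measure Exp1 {t..} = exp (- t)"
proof -
  assume t: "0 \<le> t"
  have D: "distributed Exp1 lborel (\<lambda>y. y) (exponential_density 1)"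
    by (auto simp: distributed_def erlang_density_def distr_id2)
  have "AE y in Exp1. y \<noteq> t"
    by (auto simp: AE_density intro: AE_mp[OF AE_lborel_singleton[of t]])
  then have "measure Exp1 {t..} = measure Exp1 {y \<in> space Exp1. t < y}"
    by (intro Exp1.finite_measure_eq_AE) auto
  then show ?thesis
    using Exp1.exponential_distributedD_gt[OF D t] by simp
qed

lemma Exp1_lessThan: "0 \<le> t \<Longrightarrow> measure Exp1 {..<t} = 1 - exp (- t)"
proof -
  assume t: "0 \<le> t"
  have "{..<t} = space Exp1 - {t..}" by auto
  then show ?thesis
    using Exp1.prob_compl[of "{t..}"] t by (simp add: Exp1_atLeast)
qed

lemma Exp1_atLeastLessThan:
  assumes "0 \<le> s" "s \<le> t" shows "measure Exp1 {s..<t} = exp (- s) - exp (- t)"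
proof -
  have "{s..<t} = {s..} - {t..}" by auto
  then show ?thesis
    using assms Exp1.finite_measure_Diff[of "{s..}" "{t..}"] by (simp add: Exp1_atLeast)
qed

text \<open>Serves as the measurable space of histories, that is of all waits at sites up to
  \<open>x\<close>.\<close>

definition past_measure :: "nat \<Rightarrow> (nat \<times> nat \<Rightarrow> real) measure" where
  "past_measure x = PiM ({..x} \<times> {1..}) (\<lambda>_. borel)"

section \<open>The random model and conditioning on the past\<close>

locale forest_fire = prob_space P for P :: "'w measure" +
  fixes \<theta> :: real and g :: "nat \<Rightarrow> nat \<Rightarrow> 'w \<Rightarrow> real"
  assumes theta_pos: "0 < \<theta>"
    and indep: "indep_vars (\<lambda>_. borel) (\<lambda>(x, i). g x i) (UNIV \<times> {1..})"
    and wait_exp: "\<And>x i. 1 \<le> i \<Longrightarrow> distributed P lborel (g x i) (exponential_density 1)"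
begin

abbreviation path :: "'w \<Rightarrow> nat \<Rightarrow> nat \<Rightarrow> real" where
  "path \<omega> \<equiv> \<lambda>x i. g x i \<omega>"

lemma wait_measurable [measurable]: "1 \<le> i \<Longrightarrow> g x i \<in> borel_measurable P"
  using distributed_measurable[OF wait_exp] by simp

lemma wait_gt: "1 \<le> i \<Longrightarrow> 0 \<le> t \<Longrightarrow> prob {\<omega> \<in> space P. t < g x i \<omega>} = exp (- t)"
  using exponential_distributedD_gt[OF wait_exp, of i t x] by simp

lemma AE_fire_path: "AE \<omega> in P. fire_path \<theta> (path \<omega>)"
proof -
  have "AE \<omega> in P. 0 < g x (Suc i) \<omega>" for x i
    by (subst prob_Collect_eq_1[symmetric]) (simp_all add: wait_gt)
  then have "AE \<omega> in P. \<forall>x i. 0 < g x (Suc i) \<omega>"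
    by (simp add: AE_all_countable)
  then show ?thesis
  proof eventually_elim
    case (elim \<omega>)
    show ?case
    proof
      fix x i :: nat assume "1 \<le> i"
      then show "0 < g x i \<omega>"
        using elim by (cases i) auto
    qed (rule theta_pos)
  qed
qed

text \<open>Conditioning on all waiting times at sites up to \<open>x\<close>: the first one at \<open>x + 1\<close> is a fresh
  exponential variable.\<close>

lemma nn_integral_first_wait:
  fixes h :: "(nat \<Rightarrow> nat \<Rightarrow> real) \<Rightarrow> real \<Rightarrow> ennreal"
  assumes meas: "(\<lambda>p. h (\<lambda>y j. fst p (y, j)) (snd p)) \<in> borel_measurable (past_measure x \<Otimes>\<^sub>M borel)"
    and cong: "\<And>f f' u. (\<And>y j. y \<le> x \<Longrightarrow> 1 \<le> j \<Longrightarrow> f y j = f' y j) \<Longrightarrow> h f u = h f' u"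
  shows "(\<integral>\<^sup>+ \<omega>. h (path \<omega>) (g (Suc x) 1 \<omega>) \<partial>P) = (\<integral>\<^sup>+ \<omega>. (\<integral>\<^sup>+ u. h (path \<omega>) u \<partial>Exp1) \<partial>P)"
proof -
  note One_nat_def [simp del]
  let ?A = "{..x} \<times> {1::nat..}" and ?B = "{(Suc x, 1::nat)}"
  \<comment> \<open>\<open>Z\<close> is the history up to \<open>x\<close> and \<open>Y\<close> the
    single wait at \<open>x + 1\<close>; their index sets are disjoint, hence they are
    independent.\<close>
  define Z where "Z = (\<lambda>\<omega>. restrict (\<lambda>i. (case i of (y, j) \<Rightarrow> g y j) \<omega>) ?A)"
  define Y where "Y = (\<lambda>\<omega>. restrict (\<lambda>i. (case i of (y, j) \<Rightarrow> g y j) \<omega>) ?B)"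
  have ind: "indep_var (past_measure x) Z (PiM ?B (\<lambda>_. borel)) Y"
    unfolding Z_def Y_def past_measure_def by (rule indep_var_restrict[OF indep]) auto
  have Z[measurable]: "Z \<in> measurable P (past_measure x)"
    using ind by (rule indep_var_rv1)
  have Y[measurable]: "Y \<in> measurable P (PiM ?B (\<lambda>_. borel))"
    using ind by (rule indep_var_rv2)
  have Y_apply: "Y \<omega> (Suc x, 1) = g (Suc x) 1 \<omega>" for \<omega>
    by (simp add: Y_def)
  define QY where "QY = distr P (PiM ?B (\<lambda>_. borel)) Y"
  interpret QY: prob_space QY
    unfolding QY_def by (rule prob_space_distr[OF Y])
  have sets_QY[measurable_cong]: "sets QY = sets (PiM ?B (\<lambda>_. borel))"
    by (simp add: QY_def)
  have E: "distr P borel (g (Suc x) 1) = Exp1"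
    using distributed_distr_eq_density[OF wait_exp[of 1 "Suc x"]] by (simp cong: distr_cong)
  have joint: "distr P (past_measure x) Z \<Otimes>\<^sub>M QY
      = distr P (past_measure x \<Otimes>\<^sub>M PiM ?B (\<lambda>_. borel)) (\<lambda>\<omega>. (Z \<omega>, Y \<omega>))"
    using ind unfolding indep_var_distribution_eq QY_def by simp
  define H where "H = (\<lambda>p. h (\<lambda>y j. fst p (y, j)) (snd p))"
  have H[measurable]: "H \<in> borel_measurable (past_measure x \<Otimes>\<^sub>M borel)"
    using meas by (simp add: H_def)
  have comp[measurable]: "(\<lambda>w. w (Suc x, 1)) \<in> borel_measurable (PiM ?B (\<lambda>_. borel :: real measure))"
    by (rule measurable_component_singleton) simp
  \<comment> \<open>By \<open>cong\<close>, \<open>h\<close> sees the path only through the history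
    \<open>Z\<close>; what remains is Fubini for the joint law.\<close>
  have h_eq: "h (path \<omega>) u = H (Z \<omega>, u)" for \<omega> u
    using cong[of "path \<omega>" "\<lambda>y j. Z \<omega> (y, j)" u] by (simp add: H_def Z_def)
  have inner: "(\<integral>\<^sup>+ w. H (z, w (Suc x, 1)) \<partial>QY) = (\<integral>\<^sup>+ u. H (z, u) \<partial>Exp1)"
    if [measurable]: "z \<in> space (past_measure x)" for z
    unfolding E[symmetric] QY_def by (subst (1 2) nn_integral_distr) (simp_all add: Y_apply)
  have HQ[measurable]: "(\<lambda>p. H (fst p, snd p (Suc x, 1))) \<in> borel_measurable (past_measure x \<Otimes>\<^sub>M QY)"
    by measurable
  have "(\<integral>\<^sup>+ \<omega>. h (path \<omega>) (g (Suc x) 1 \<omega>) \<partial>P)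
      = (\<integral>\<^sup>+ p. H (fst p, snd p (Suc x, 1)) \<partial>(distr P (past_measure x) Z \<Otimes>\<^sub>M QY))"
    unfolding joint h_eq by (subst nn_integral_distr) (simp_all add: Y_apply)
  also have "\<dots> = (\<integral>\<^sup>+ z. (\<integral>\<^sup>+ w. H (z, w (Suc x, 1)) \<partial>QY) \<partial>distr P (past_measure x) Z)"
    by (subst QY.nn_integral_fst[symmetric]) simp_all
  also have "\<dots> = (\<integral>\<^sup>+ \<omega>. (\<integral>\<^sup>+ w. H (Z \<omega>, w (Suc x, 1)) \<partial>QY) \<partial>P)"
    using QY.borel_measurable_nn_integral_fst[OF HQ] by (subst nn_integral_distr) simp_all
  also have "\<dots> = (\<integral>\<^sup>+ \<omega>. (\<integral>\<^sup>+ u. h (path \<omega>) u \<partial>Exp1) \<partial>P)"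
    unfolding h_eq using inner measurable_space[OF Z] by (intro nn_integral_cong) simp
  finally show ?thesis .
qed

end

section \<open>Late burnings of record sites\<close>

text \<open>After its \<open>(j + 1)\<close>-st burning, over by time \<open>2 log x\<close>, site \<open>x\<close> does not burn again before
  \<open>C log x\<close>. Below, \<open>u\<close> stands for the time of the first tree at \<open>x + 1\<close>, which is late if it misses
  that burning and timely if it is ignited by it.\<close>

definition stalls :: "real \<Rightarrow> real \<Rightarrow> (nat \<Rightarrow> nat \<Rightarrow> real) \<Rightarrow> nat \<Rightarrow> nat \<Rightarrow> bool" where
  "stalls C \<theta> g x j \<longleftrightarrow> 1 \<le> j \<and> burn \<theta> g x (Suc j) + \<theta> \<le> 2 * ln (real x) \<and>
     C * ln (real x) < burn \<theta> g x (Suc (Suc j))"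

definition late_tree :: "real \<Rightarrow> real \<Rightarrow> (nat \<Rightarrow> nat \<Rightarrow> real) \<Rightarrow> nat \<Rightarrow> real \<Rightarrow> bool" where
  "late_tree C \<theta> g x u \<longleftrightarrow> (\<exists>j. stalls C \<theta> g x j \<and> burn \<theta> g x (Suc j) + \<theta> \<le> u)"

definition timely_tree :: "real \<Rightarrow> real \<Rightarrow> (nat \<Rightarrow> nat \<Rightarrow> real) \<Rightarrow> nat \<Rightarrow> real \<Rightarrow> bool" where
  "timely_tree C \<theta> g x u \<longleftrightarrow>
     (\<exists>j. stalls C \<theta> g x j \<and> burn \<theta> g x j + \<theta> \<le> u \<and> u < burn \<theta> g x (Suc j) + \<theta>)"

lemma
  assumes "\<And>y j. y \<le> x \<Longrightarrow> 1 \<le> j \<Longrightarrow> g y j = g' y j"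
  shows late_tree_cong: "late_tree C \<theta> g x u = late_tree C \<theta> g' x u"
    and timely_tree_cong: "timely_tree C \<theta> g x u = timely_tree C \<theta> g' x u"
proof -
  have "burn \<theta> g x k = burn \<theta> g' x k" for k
    by (rule burn_cong) (rule assms)
  then show "late_tree C \<theta> g x u = late_tree C \<theta> g' x u"
    "timely_tree C \<theta> g x u = timely_tree C \<theta> g' x u"
    by (simp_all add: late_tree_def timely_tree_def stalls_def)
qed

lemma record_site_cong:
  assumes "\<And>y j. y \<le> Suc x \<Longrightarrow> 1 \<le> j \<Longrightarrow> g y j = g' y j"
  shows "record_site \<theta> g x = record_site \<theta> g' x"
  using burn_cong[of x g g' \<theta> 1] assms by (simp add: record_site_def)

lemma
  assumes g: "\<And>y j. y \<le> x \<Longrightarrow> 1 \<le> j \<Longrightarrow> g y j \<in> borel_measurable M"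
    and u [measurable]: "u \<in> borel_measurable M"
  shows measurable_late_tree: "Measurable.pred M (\<lambda>\<omega>. late_tree C \<theta> (\<lambda>y j. g y j \<omega>) x (u \<omega>))"
    and measurable_timely_tree: "Measurable.pred M (\<lambda>\<omega>. timely_tree C \<theta> (\<lambda>y j. g y j \<omega>) x (u \<omega>))"
proof -
  have [measurable]: "(\<lambda>\<omega>. burn \<theta> (\<lambda>y j. g y j \<omega>) x k) \<in> borel_measurable M" for k
    by (rule measurable_burn) (rule g)
  show "Measurable.pred M (\<lambda>\<omega>. late_tree C \<theta> (\<lambda>y j. g y j \<omega>) x (u \<omega>))"
    "Measurable.pred M (\<lambda>\<omega>. timely_tree C \<theta> (\<lambda>y j. g y j \<omega>) x (u \<omega>))"
    unfolding late_tree_def timely_tree_def stalls_def by measurable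
qed

lemma measurable_record_site:
  assumes g: "\<And>y j. y \<le> Suc x \<Longrightarrow> 1 \<le> j \<Longrightarrow> g y j \<in> borel_measurable M"
  shows "Measurable.pred M (\<lambda>\<omega>. record_site \<theta> (\<lambda>y j. g y j \<omega>) x)"
proof -
  have [measurable]: "(\<lambda>\<omega>. burn \<theta> (\<lambda>y j. g y j \<omega>) x k) \<in> borel_measurable M" for k
    by (rule measurable_burn) (simp add: g)
  have [measurable]: "g (Suc x) 1 \<in> borel_measurable M"
    by (simp add: g)
  show ?thesis
    unfolding record_site_def by measurable
qed

lemma measurable_past [measurable]:
  assumes "y \<le> x" "1 \<le> j"
  shows "(\<lambda>p. fst p (y, j)) \<in> borel_measurable (past_measure x \<Otimes>\<^sub>M borel)"
  unfolding past_measure_def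
  by (rule measurable_compose[OF measurable_fst measurable_component_singleton]) (use assms in auto)

lemma ln_real_nonneg: "0 \<le> ln (real n)"
  by (cases n) auto

context fire_path
begin

text \<open>A stall places both \<open>2 * ln x\<close> and \<open>C * ln x\<close> in one gap
  between consecutive burnings of \<open>x\<close>, and only one gap can contain them.\<close>

lemma stalls_unique:
  assumes "stalls C \<theta> g x i" "stalls C \<theta> g x j" "2 \<le> C"
  shows "i = j"
proof -
  have less: False if "stalls C \<theta> g x i" "stalls C \<theta> g x j" "i < j" for i j
  proof -
    have "C * ln (real x) < b x (Suc (Suc i))" "b x (Suc j) + \<theta> \<le> 2 * ln (real x)"
      using that by (auto simp: stalls_def)
    moreover have "b x (Suc (Suc i)) \<le> b x (Suc j)"
      using that by (simp add: burn_le_iff)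
    moreover have "2 * ln (real x) \<le> C * ln (real x)"
      using assms(3) by (intro mult_right_mono) (auto intro: ln_real_nonneg)
    ultimately show False
      using theta_pos by linarith
  qed
  show ?thesis
    using less[of i j] less[of j i] assms(1,2) by (cases i j rule: linorder_cases) auto
qed

text \<open>For the unique stalled index, late means \<open>u\<close> in [t, oo) and timely means
  \<open>u\<close> in [s, t), where t - s >= theta. Then exp (-t) exp theta <= exp (-s), which gives
  the constant 1 / (exp theta - 1).\<close>

lemma late_tree_le_timely_tree:
  assumes "2 \<le> C"
  shows "(\<integral>\<^sup>+ u. indicator {u. late_tree C \<theta> g x u} u \<partial>Exp1)
    \<le> (\<integral>\<^sup>+ u. ennreal (1 / (exp \<theta> - 1)) * indicator {u. timely_tree C \<theta> g x u} u \<partial>Exp1)"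
proof (cases "\<exists>j. stalls C \<theta> g x j")
  case False
  then show ?thesis by (simp add: late_tree_def)
next
  case True
  then obtain j where j: "stalls C \<theta> g x j" ..
  define s t where "s = b x j + \<theta>" and "t = b x (Suc j) + \<theta>"
  have "1 \<le> j" using j by (simp add: stalls_def)
  then have st: "0 \<le> s" "s + \<theta> \<le> t"
    using burn_pos[of j x] burn_step[of x j] theta_pos by (auto simp: s_def t_def)
  have uniq: "stalls C \<theta> g x k \<longleftrightarrow> k = j" for k
    using j stalls_unique[OF j _ assms, of k] by blast
  have late: "{u. late_tree C \<theta> g x u} = {t..}"
    by (auto simp: uniq late_tree_def t_def)
  have timely: "{u. timely_tree C \<theta> g x u} = {s..<t}"
    by (auto simp: uniq timely_tree_def s_def t_def)
  have e: "exp \<theta> > 1" using theta_pos by simp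
  have "exp (- t) * exp \<theta> \<le> exp (- s)"
    using st by (simp add: exp_add[symmetric])
  then have "exp (- t) \<le> 1 / (exp \<theta> - 1) * (exp (- s) - exp (- t))"
    using e by (simp add: field_simps)
  then show ?thesis
    unfolding late timely using e st theta_pos
    by (simp add: nn_integral_cmult Exp1.emeasure_eq_measure Exp1_atLeast Exp1_atLeastLessThan
        ennreal_mult'[symmetric])
qed

end

context forest_fire
begin

lemma measurable_burn_path [measurable]: "(\<lambda>\<omega>. burn \<theta> (path \<omega>) x i) \<in> borel_measurable P"
  by (rule measurable_burn) simp

lemma measurable_record_path [measurable]: "Measurable.pred P (\<lambda>\<omega>. record_site \<theta> (path \<omega>) x)"
  by (rule measurable_record_site) simp

lemma measurable_late_path [measurable]:
  "Measurable.pred P (\<lambda>\<omega>. late_tree C \<theta> (path \<omega>) x (g (Suc x) 1 \<omega>))"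
  by (rule measurable_late_tree) simp_all

lemma measurable_timely_path [measurable]:
  "Measurable.pred P (\<lambda>\<omega>. timely_tree C \<theta> (path \<omega>) x (g (Suc x) 1 \<omega>))"
  by (rule measurable_timely_tree) simp_all

lemma AE_late_tree_finitely_often:
  assumes "2 \<le> C"
  shows "AE \<omega> in P. (\<forall>\<^sub>F x in sequentially. \<not> timely_tree C \<theta> (path \<omega>) x (g (Suc x) 1 \<omega>)) \<longrightarrow>
    (\<forall>\<^sub>F x in sequentially. \<not> late_tree C \<theta> (path \<omega>) x (g (Suc x) 1 \<omega>))"
proof -
  define A where "A x = {\<omega> \<in> space P. late_tree C \<theta> (path \<omega>) x (g (Suc x) 1 \<omega>)}" for x
  define B where "B x = {\<omega> \<in> space P. timely_tree C \<theta> (path \<omega>) x (g (Suc x) 1 \<omega>)}" for x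
  define \<kappa> where "\<kappa> = 1 / (exp \<theta> - 1)"
  have [measurable]: "A x \<in> events" "B x \<in> events" for x
    unfolding A_def B_def by measurable
  have "\<kappa> \<ge> 0" using theta_pos by (simp add: \<kappa>_def)
  have "prob (A (N + i) - (\<Union>j<i. B (N + j))) \<le> \<kappa> * prob (B (N + i) - (\<Union>j<i. B (N + j)))" for N i
  proof -
    \<comment> \<open>\<open>R\<close> says that none of the sites N, ..., N + i - 1 has a timely
      tree. It involves waits at sites up to N + i only, so it is part of the past when the wait at
      N + i + 1 is integrated out.\<close>
    define R :: "(nat \<Rightarrow> nat \<Rightarrow> real) \<Rightarrow> bool"
      where "R f \<longleftrightarrow> (\<forall>j\<in>{..<i}. \<not> timely_tree C \<theta> f (N + j) (f (Suc (N + j)) 1))" for f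
    have R_cong: "R f = R f'" if "\<And>y j. y \<le> N + i \<Longrightarrow> 1 \<le> j \<Longrightarrow> f y j = f' y j" for f f'
    proof -
      have "timely_tree C \<theta> f (N + j) (f (Suc (N + j)) 1) = timely_tree C \<theta> f' (N + j) (f' (Suc (N + j)) 1)"
        if "j < i" for j
        using \<open>j < i\<close> \<open>\<And>y j. y \<le> N + i \<Longrightarrow> 1 \<le> j \<Longrightarrow> f y j = f' y j\<close>
          timely_tree_cong[of "N + j" f f' C \<theta>] by simp
      then show ?thesis by (simp add: R_def)
    qed
    have R_meas [measurable]: "Measurable.pred (past_measure (N + i) \<Otimes>\<^sub>M borel) (\<lambda>p. R (\<lambda>y j. fst p (y, j)))"
      unfolding R_def
    proof (intro pred_intros_finite pred_intros_logic)
      fix j assume "j \<in> {..<i}"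
      then show "Measurable.pred (past_measure (N + i) \<Otimes>\<^sub>M borel)
         (\<lambda>p. timely_tree C \<theta> (\<lambda>y j. fst p (y, j)) (N + j) (fst p (Suc (N + j), 1)))"
        by (intro measurable_timely_tree measurable_past) auto
    qed simp
    define h :: "ennreal \<Rightarrow> ((nat \<Rightarrow> nat \<Rightarrow> real) \<Rightarrow> nat \<Rightarrow> real \<Rightarrow> bool) \<Rightarrow> (nat \<Rightarrow> nat \<Rightarrow> real) \<Rightarrow> real \<Rightarrow> ennreal"
      where "h c T f u = (if R f \<and> T f (N + i) u then c else 0)" for c T f u
    have h_split: "(\<integral>\<^sup>+ \<omega>. h c T (path \<omega>) (g (Suc (N + i)) 1 \<omega>) \<partial>P) = (\<integral>\<^sup>+ \<omega>. (\<integral>\<^sup>+ u. h c T (path \<omega>) u \<partial>Exp1) \<partial>P)"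
      if [measurable]: "Measurable.pred (past_measure (N + i) \<Otimes>\<^sub>M borel) (\<lambda>p. T (\<lambda>y j. fst p (y, j)) (N + i) (snd p))"
        and T_cong: "\<And>f f' u. (\<And>y j. y \<le> N + i \<Longrightarrow> 1 \<le> j \<Longrightarrow> f y j = f' y j) \<Longrightarrow> T f (N + i) u = T f' (N + i) u"
      for c T
    proof (rule nn_integral_first_wait)
      show "(\<lambda>p. h c T (\<lambda>y j. fst p (y, j)) (snd p)) \<in> borel_measurable (past_measure (N + i) \<Otimes>\<^sub>M borel)"
        unfolding h_def by measurable
      show "h c T f u = h c T f' u" if "\<And>y j. y \<le> N + i \<Longrightarrow> 1 \<le> j \<Longrightarrow> f y j = f' y j" for f f' u
        using R_cong[OF that] T_cong[OF that] by (simp add: h_def)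
    qed
    have emA: "emeasure P (A (N + i) - (\<Union>j<i. B (N + j)))
       = (\<integral>\<^sup>+ \<omega>. h 1 (late_tree C \<theta>) (path \<omega>) (g (Suc (N + i)) 1 \<omega>) \<partial>P)"
    proof -
      have "(\<integral>\<^sup>+ \<omega>. h 1 (late_tree C \<theta>) (path \<omega>) (g (Suc (N + i)) 1 \<omega>) \<partial>P)
          = (\<integral>\<^sup>+ \<omega>. indicator (A (N + i) - (\<Union>j<i. B (N + j))) \<omega> \<partial>P)"
        by (rule nn_integral_cong) (simp add: h_def R_def A_def B_def indicator_def)
      then show ?thesis by simp
    qed
    have emB: "ennreal \<kappa> * emeasure P (B (N + i) - (\<Union>j<i. B (N + j)))
       = (\<integral>\<^sup>+ \<omega>. h \<kappa> (timely_tree C \<theta>) (path \<omega>) (g (Suc (N + i)) 1 \<omega>) \<partial>P)"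
    proof -
      have "(\<integral>\<^sup>+ \<omega>. h \<kappa> (timely_tree C \<theta>) (path \<omega>) (g (Suc (N + i)) 1 \<omega>) \<partial>P)
          = (\<integral>\<^sup>+ \<omega>. ennreal \<kappa> * indicator (B (N + i) - (\<Union>j<i. B (N + j))) \<omega> \<partial>P)"
        by (rule nn_integral_cong) (simp add: h_def R_def B_def indicator_def)
      then show ?thesis by (simp add: nn_integral_cmult_indicator)
    qed
    have "emeasure P (A (N + i) - (\<Union>j<i. B (N + j)))
        = (\<integral>\<^sup>+ \<omega>. (\<integral>\<^sup>+ u. h 1 (late_tree C \<theta>) (path \<omega>) u \<partial>Exp1) \<partial>P)"
      unfolding emA by (intro h_split measurable_late_tree measurable_past late_tree_cong) simp_all
    also have "\<dots> \<le> (\<integral>\<^sup>+ \<omega>. (\<integral>\<^sup>+ u. h \<kappa> (timely_tree C \<theta>) (path \<omega>) u \<partial>Exp1) \<partial>P)"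
    proof (intro nn_integral_mono_AE, use AE_fire_path in eventually_elim)
      case (elim \<omega>)
      have "h c T f u = (if R f then c * indicator {u. T f (N + i) u} u else 0)" for c T f u
        by (simp add: h_def indicator_def)
      then show ?case
        using fire_path.late_tree_le_timely_tree[OF elim assms, of "N + i"]
        by (cases "R (path \<omega>)") (simp_all add: \<kappa>_def)
    qed
    also have "\<dots> = ennreal \<kappa> * emeasure P (B (N + i) - (\<Union>j<i. B (N + j)))"
      unfolding emB by (intro h_split[symmetric] measurable_timely_tree measurable_past timely_tree_cong) simp_all
    finally show ?thesis
      using \<open>\<kappa> \<ge> 0\<close> by (simp add: emeasure_eq_measure ennreal_mult'[symmetric])
  qed
  then have "AE \<omega> in P. (\<forall>\<^sub>F x in sequentially. \<omega> \<notin> B x) \<longrightarrow> (\<forall>\<^sub>F x in sequentially. \<omega> \<notin> A x)"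
    by (intro AE_finitely_often_transfer) simp_all
  with AE_space show ?thesis
    by eventually_elim (simp add: A_def B_def)
qed

end

section \<open>Spacing of record sites\<close>

text \<open>
  As long as no record site is met, the front time \<open>v = f\<^bsub>x,1\<^esub>\<close> moves up by less than \<open>\<theta>\<close> when the next
  waiting time lies in \<open>[v, v + \<theta>)\<close>, and a waiting time of at least \<open>v + \<theta>\<close> produces a record site.
  With \<open>exp (l \<theta>) (1 - exp (-\<theta>)) = 1\<close> this makes the weight below a supermartingale in \<open>x\<close>.
\<close>

definition front_weight :: "real \<Rightarrow> real \<Rightarrow> nat \<Rightarrow> (nat \<Rightarrow> nat \<Rightarrow> real) \<Rightarrow> nat \<Rightarrow> ennreal" where
  "front_weight l \<theta> n g x =
     (if burn \<theta> g (Suc n) 1 \<le> 2 * ln (real n) \<and> (\<forall>y\<in>{n<..<x}. \<not> record_site \<theta> g y)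
      then ennreal (exp (l * burn \<theta> g x 1)) else 0)"

text \<open>The weight at \<open>x + 1\<close> split into the past and a fresh wait
  \<open>u\<close>, the form that \<open>nn_integral_first_wait\<close> handles.\<close>

definition front_weight_step :: "real \<Rightarrow> real \<Rightarrow> nat \<Rightarrow> nat \<Rightarrow> (nat \<Rightarrow> nat \<Rightarrow> real) \<Rightarrow> real \<Rightarrow> ennreal" where
  "front_weight_step l \<theta> n x g u =
     (if (burn \<theta> g (Suc n) 1 \<le> 2 * ln (real n) \<and> (\<forall>y\<in>{n<..<x}. \<not> record_site \<theta> g y)) \<and>
        u < burn \<theta> g x 1 + \<theta>
      then ennreal (exp (l * max u (burn \<theta> g x 1))) else 0)"

context fire_path
begin

lemma front_weight_Suc:
  assumes "n < x"
  shows "front_weight l \<theta> n g (Suc x) = front_weight_step l \<theta> n x g (g (Suc x) 1)"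
proof -
  have "{n<..<Suc x} = insert x {n<..<x}" using assms by auto
  moreover have "record_site \<theta> g x \<longleftrightarrow> \<not> g (Suc x) 1 < b x 1 + \<theta>"
    by (simp add: record_site_def not_less)
  ultimately show ?thesis
    using first_burn_not_record[of x] by (auto simp: front_weight_def front_weight_step_def)
qed

text \<open>With v the front time, a wait below v leaves the weight at exp (l v), one in [v, v +
  theta) gives at most exp (l (v + theta)), and a longer one gives 0. By the choice of l these
  contributions add up to exp (l v).\<close>

lemma integral_front_weight_step:
  assumes "0 < l" and l: "exp (l * \<theta>) * (1 - exp (- \<theta>)) = 1"
  shows "(\<integral>\<^sup>+ u. front_weight_step l \<theta> n x g u \<partial>Exp1) \<le> front_weight l \<theta> n g x"
proof (cases "b (Suc n) 1 \<le> 2 * ln (real n) \<and> (\<forall>y\<in>{n<..<x}. \<not> record_site \<theta> g y)")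
  case True
  define v where "v = b x 1"
  have v: "0 < v" by (simp add: v_def burn_pos)
  have "(\<integral>\<^sup>+ u. front_weight_step l \<theta> n x g u \<partial>Exp1)
      \<le> (\<integral>\<^sup>+ u. ennreal (exp (l * v)) * indicator {..<v} u +
             ennreal (exp (l * (v + \<theta>))) * indicator {v..<v + \<theta>} u \<partial>Exp1)"
    using assms(1)
    by (intro nn_integral_mono) (auto simp: front_weight_step_def v_def indicator_def not_less)
  also have "\<dots> = ennreal (exp (l * v)) * (1 - exp (- v))
      + ennreal (exp (l * (v + \<theta>))) * (exp (- v) - exp (- (v + \<theta>)))"
    using v theta_pos
    by (simp add: nn_integral_add nn_integral_cmult Exp1.emeasure_eq_measure Exp1_lessThan Exp1_atLeastLessThan)
  also have "\<dots> = ennreal (exp (l * v) * (1 - exp (- v)) + exp (l * (v + \<theta>)) * (exp (- v) - exp (- (v + \<theta>))))"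
    using v theta_pos by (simp add: ennreal_mult ennreal_plus)
  also have "exp (l * v) * (1 - exp (- v)) + exp (l * (v + \<theta>)) * (exp (- v) - exp (- (v + \<theta>)))
      = exp (l * v) * (1 - exp (- v)) + exp (l * v) * exp (- v) * (exp (l * \<theta>) * (1 - exp (- \<theta>)))"
    by (simp add: algebra_simps exp_add[symmetric])
  also have "\<dots> = exp (l * v)"
    unfolding l by (simp add: algebra_simps)
  also have "ennreal (exp (l * v)) = front_weight l \<theta> n g x"
    using True by (simp add: front_weight_def v_def)
  finally show ?thesis .
next
  case False
  then have "front_weight_step l \<theta> n x g u = 0" for u
    unfolding front_weight_step_def by (intro if_not_P) blast
  then show ?thesis by simp
qed

section \<open>Pathwise consequences of the almost sure bounds\<close>

lemma timely_treeD:
  assumes "timely_tree C \<theta> g n (g (Suc n) 1)"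
  shows "b (Suc n) 1 \<le> 2 * ln (real n)" and "C * ln (real n) < b (Suc n) 2"
proof -
  obtain j where j: "stalls C \<theta> g n j" and u: "b n j + \<theta> \<le> g (Suc n) 1" "g (Suc n) 1 < b n (Suc j) + \<theta>"
    using assms by (auto simp: timely_tree_def)
  have "ign n 1 \<le> Suc j"
    \<comment> \<open>The tree appears after burning j is over and before burning j + 1 is over, so
      its igniter is exactly j + 1.\<close>
    using u(2) by (intro igniter_le) (simp_all only: tree_time_first)
  moreover have "b n j < b n (ign n 1)"
    using u(1) less_burn_igniter[of "tree_time \<theta> g (Suc n) 1" n] by (simp only: tree_time_first)
  ultimately have ign: "ign n 1 = Suc j"
    by (simp add: burn_less_iff)
  show "b (Suc n) 1 \<le> 2 * ln (real n)"
    using j u first_burn_eq[of n] theta_pos unfolding ign stalls_def by linarith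
  show "C * ln (real n) < b (Suc n) 2"
    using j second_burn_ge[of n] unfolding ign stalls_def by linarith
qed

text \<open>By \<open>tall\<close>, some wait before n^p pushes the front above
  \<open>q * ln n\<close>; by \<open>front\<close>, after a timely tree this forces a record site m
  in (n, n^p). Then \<open>second\<close> bounds the second burning of m by c p log n <= C log n,
  but the stall at n already delays it beyond C log n.\<close>

lemma eventually_not_timely_tree:
  assumes tall: "\<forall>\<^sub>F n in sequentially. \<not> (\<forall>x\<in>{n + 2..n ^ p}. g x 1 \<le> q * ln (real n))"
    and front: "\<forall>\<^sub>F n in sequentially. \<not> (b (Suc n) 1 \<le> 2 * ln (real n) \<and>
           (\<forall>y\<in>{n<..<n ^ p}. \<not> record_site \<theta> g y) \<and> q * ln (real n) < b (n ^ p) 1)"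
    and second: "\<forall>\<^sub>F n in sequentially. record_site \<theta> g n \<longrightarrow> b n 2 \<le> c * ln (real n)"
    and c: "0 \<le> c" "c * real p \<le> C"
  shows "\<forall>\<^sub>F n in sequentially. \<not> timely_tree C \<theta> g n (g (Suc n) 1)"
proof -
  obtain N where N: "\<And>n. N \<le> n \<Longrightarrow> record_site \<theta> g n \<longrightarrow> b n 2 \<le> c * ln (real n)"
    using second by (auto simp: eventually_sequentially)
  from tall front eventually_ge_at_top[of "max 1 N"] show ?thesis
  proof eventually_elim
    case (elim n)
    show ?case
    proof
      assume t: "timely_tree C \<theta> g n (g (Suc n) 1)"
      from elim obtain x where x: "n + 2 \<le> x" "x \<le> n ^ p" "q * ln (real n) < g x 1"
        by (auto simp: not_le)
      have "g x 1 \<le> b x 1"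
        using tree_time_le_burn[of 1 x] by (simp only: tree_time_first order_refl)
      also have "\<dots> \<le> b (n ^ p) 1"
        using x by (intro burn_mono_site) auto
      finally obtain m where m: "n < m" "m < n ^ p" "record_site \<theta> g m"
        using elim(2) timely_treeD(1)[OF t] x(3) by auto
      have "b (Suc n) 2 \<le> b m 2"
        using m by (intro burn_mono_site) auto
      also have "\<dots> \<le> c * ln (real m)"
        using N[of m] m elim by auto
      also have "\<dots> \<le> c * ln (real n ^ p)"
        using m c elim by (intro mult_left_mono) (simp_all flip: of_nat_power)
      also have "\<dots> = (c * real p) * ln (real n)"
        using elim by (simp add: ln_realpow)
      also have "\<dots> \<le> C * ln (real n)"
        using c by (intro mult_right_mono ln_real_nonneg)
      finally show False
        using timely_treeD(2)[OF t] by simp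
    qed
  qed
qed

text \<open>At a record site the igniter is either the second burning, bounded by
  \<open>second\<close>, or a later one, which beyond C log n would mean a late tree. This yields
  f(n+1,1) <= max (C log (n+1)) f(n,1), which is iterated.\<close>

lemma eventually_first_burn_le:
  assumes first: "\<forall>\<^sub>F n in sequentially. g (Suc n) 1 \<le> 2 * ln (real n)"
    and second: "\<forall>\<^sub>F n in sequentially. record_site \<theta> g n \<longrightarrow> b n 2 \<le> c * ln (real n)"
    and late: "\<forall>\<^sub>F n in sequentially. \<not> late_tree C \<theta> g n (g (Suc n) 1)"
    and C: "2 \<le> C" "c \<le> C"
  shows "\<forall>\<^sub>F n in sequentially. b n 1 \<le> C * ln (real n)"
proof -
  have mono: "a * ln (real n) \<le> C * ln (real n)" if "a \<le> C" for a n
    using that by (intro mult_right_mono ln_real_nonneg)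
  have "\<forall>\<^sub>F n in sequentially. b (Suc n) 1 \<le> max (C * ln (real (Suc n))) (b n 1)"
    using first second late eventually_gt_at_top[of 0]
  proof eventually_elim
    case (elim n)
    have "ln (real n) \<le> ln (real (Suc n))" using elim by simp
    then have ln_Suc: "C * ln (real n) \<le> C * ln (real (Suc n))"
      using C by (intro mult_left_mono) auto
    have g: "g (Suc n) 1 \<le> C * ln (real n)"
      using elim(1) mono[OF C(1), of n] by linarith
    show ?case
    proof (cases "record_site \<theta> g n")
      case False
      then show ?thesis
        using first_burn_not_record[of n] g ln_Suc by linarith
    next
      case True
      have "b n (ign n 1) \<le> C * ln (real n)"
      proof (rule ccontr)
        assume less: "\<not> ?thesis"
        have "ign n 1 \<noteq> 2"
        proof
          assume "ign n 1 = 2"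
          then show False
            using less elim(2) True mono[OF C(2), of n] by (simp only: simp_thms)
        qed
        then have "2 < ign n 1"
          using True[unfolded record_site_iff] by linarith
        then obtain j where j: "ign n 1 = Suc (Suc j)" "1 \<le> j"
          by (intro that[of "ign n 1 - 2"]) linarith+
        \<comment> \<open>Otherwise burning j + 1 or an earlier one would ignite the tree. As the
          tree is there by \<open>2 * ln n\<close>, burning j + 1 is over by then, as a stall
          requires.\<close>
        have "b n (Suc j) + \<theta> \<le> g (Suc n) 1"
        proof (rule ccontr)
          assume "\<not> ?thesis"
          then have "ign n 1 \<le> Suc j"
            by (intro igniter_le) (simp_all only: tree_time_first not_le le_add1 plus_1_eq_Suc[symmetric])
          then show False
            using j(1) by linarith
        qed
        then have "late_tree C \<theta> g n (g (Suc n) 1)"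
          using less j elim(1) unfolding late_tree_def stalls_def by (intro exI[of _ j]) auto
        with elim(3) show False by contradiction
      qed
      then show ?thesis
        using first_burn_eq[of n] g ln_Suc by linarith
    qed
  qed
  then obtain N where N: "\<And>n. N \<le> n \<Longrightarrow> b (Suc n) 1 \<le> max (C * ln (real (Suc n))) (b n 1)"
    by (auto simp: eventually_sequentially)
  have bound: "b n 1 \<le> max (C * ln (real n)) (b (max 1 N) 1)" if "max 1 N \<le> n" for n
    using that
  proof (induction n rule: dec_induct)
    case (step n)
    have "ln (real n) \<le> ln (real (Suc n))" using step by simp
    then have "C * ln (real n) \<le> C * ln (real (Suc n))"
      using C by (intro mult_left_mono) auto
    then show ?case
      using step N[of n] by linarith
  qed simp
  \<comment> \<open>The first burning time at the starting site is a constant, eventually absorbed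
    by \<open>C * ln n\<close>.\<close>
  have "\<forall>\<^sub>F n in sequentially. b (max 1 N) 1 / C \<le> ln (real n)"
    using filterlim_compose[OF ln_at_top filterlim_real_sequentially]
    by (auto simp: filterlim_at_top)
  then show ?thesis
    using eventually_ge_at_top[of "max 1 N"]
  proof eventually_elim
    case (elim n)
    then have "b (max 1 N) 1 \<le> C * ln (real n)"
      using C by (simp add: field_simps)
    then show ?case
      using bound[of n] elim by linarith
  qed
qed

end

section \<open>Almost sure bounds for waits and for the front\<close>

lemma exp_minus_ln_nat: "0 < n \<Longrightarrow> exp (- (2 * ln (real n))) = inverse (real n ^ 2)"
  using exp_double[of "ln (real n)"] by (simp add: exp_minus)

context forest_fire
begin

text \<open>The factor 2 makes the tail probability n^(-2), which is summable.\<close>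

lemma AE_first_wait_le:
  "AE \<omega> in P. \<forall>\<^sub>F n in sequentially. g (Suc n) 1 \<omega> \<le> 2 * ln (real n)"
proof -
  have "AE \<omega> in P. \<forall>\<^sub>F n in sequentially. \<not> 2 * ln (real n) < g (Suc n) 1 \<omega>"
  proof (rule AE_finitely_often)
    show "\<forall>\<^sub>F n in sequentially. prob {\<omega> \<in> space P. 2 * ln (real n) < g (Suc n) 1 \<omega>} \<le> inverse (real n ^ 2)"
      using eventually_gt_at_top[of 0]
    proof eventually_elim
      case (elim n)
      then show ?case
        using wait_gt[of 1 "2 * ln (real n)" "Suc n"] exp_minus_ln_nat[OF elim] by simp
    qed
  qed (simp_all add: inverse_power_summable)
  then show ?thesis by (simp add: not_less)
qed

text \<open>There are at least n^(p-1) independent waits, each above q log n with probability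
  n^(-q). As p - 1 - q >= 1, all of them fail with probability at most exp (-n).\<close>

lemma AE_first_wait_exceeds:
  assumes q: "0 \<le> q" and p: "q + 2 \<le> real p"
  shows "AE \<omega> in P. \<forall>\<^sub>F n in sequentially. \<not> (\<forall>x\<in>{n + 2..n ^ p}. g x 1 \<omega> \<le> q * ln (real n))"
proof (rule AE_finitely_often)
  have "prob {\<omega> \<in> space P. \<forall>x\<in>{n + 2..n ^ p}. g x 1 \<omega> \<le> q * ln (real n)} \<le> exp (- real n)" if n: "3 \<le> n" for n
  proof -
    have p2: "2 \<le> p" using p q by linarith
    define k where "k = n ^ (p - 1)"
    have np: "n ^ p = n * k" using p2 unfolding k_def by (cases p) auto
    \<comment> \<open>For n >= 3 the range has n k - n - 1 >= 3 k - k - 1 >= k elements.\<close>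
    have "n \<le> k" unfolding k_def using p2 n by (intro self_le_power) auto
    moreover have "3 * k \<le> n * k" using n by simp
    moreover have "card {n + 2..n ^ p} = n * k - Suc n"
      by (simp add: np)
    ultimately have card: "k \<le> card {n + 2..n ^ p}" "n + 2 \<le> n ^ p"
      unfolding np using n by linarith+
    let ?J = "{n + 2..n ^ p} \<times> {1::nat}"
    have "prob {\<omega> \<in> space P. \<forall>x\<in>{n + 2..n ^ p}. g x 1 \<omega> \<le> q * ln (real n)}
       = prob (\<Inter>i\<in>?J. (case i of (x, i) \<Rightarrow> g x i) -` {..q * ln (real n)} \<inter> space P)"
      using card by (intro arg_cong[where f=prob]) auto
    also have "\<dots> = (\<Prod>i\<in>?J. prob ((case i of (x, i) \<Rightarrow> g x i) -` {..q * ln (real n)} \<inter> space P))"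
      using card by (intro indep_varsD[OF indep]) auto
    also have "\<dots> = (\<Prod>i\<in>?J. 1 - exp (- (q * ln (real n))))"
    proof (intro prod.cong refl)
      fix i assume "i \<in> ?J"
      then obtain x where i: "i = (x, 1)" by auto
      have "(case i of (x, i) \<Rightarrow> g x i) -` {..q * ln (real n)} \<inter> space P
          = {\<omega> \<in> space P. g x 1 \<omega> \<le> q * ln (real n)}"
        unfolding i by auto
      then show "prob ((case i of (x, i) \<Rightarrow> g x i) -` {..q * ln (real n)} \<inter> space P) = 1 - exp (- (q * ln (real n)))"
        using exponential_distributedD_le[OF wait_exp[of 1 x], of "q * ln (real n)"] q n by simp
    qed
    also have "\<dots> = (1 - exp (- (q * ln (real n)))) ^ card {n + 2..n ^ p}"
      by (simp add: card_cartesian_product)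
    also have "\<dots> \<le> exp (- exp (- (q * ln (real n)))) ^ card {n + 2..n ^ p}"
      using exp_ge_add_one_self[of "- exp (- (q * ln (real n)))"] q n by (intro power_mono) auto
    also have "\<dots> = exp (- (real (card {n + 2..n ^ p}) * exp (- (q * ln (real n)))))"
      by (simp add: exp_of_nat_mult[symmetric])
    also have "\<dots> \<le> exp (- real n)"
    proof -
      have "real n = exp (ln (real n))" using n by simp
      also have "\<dots> \<le> exp ((real p - 1 - q) * ln (real n))"
        using mult_right_mono[OF _ ln_real_nonneg, of 1 "real p - 1 - q" n] p by simp
      also have "\<dots> = exp (real (p - 1) * ln (real n)) * exp (- (q * ln (real n)))"
        using p2 by (simp add: exp_add[symmetric] algebra_simps of_nat_diff)
      also have "exp (real (p - 1) * ln (real n)) = real k"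
        unfolding k_def using n by (simp add: exp_of_nat_mult)
      also have "real k * exp (- (q * ln (real n))) \<le> real (card {n + 2..n ^ p}) * exp (- (q * ln (real n)))"
        by (rule mult_right_mono) (simp_all only: of_nat_le_iff card exp_ge_zero)
      finally show ?thesis by simp
    qed
    finally show ?thesis .
  qed
  then show "\<forall>\<^sub>F n in sequentially. prob {\<omega> \<in> space P. \<forall>x\<in>{n + 2..n ^ p}. g x 1 \<omega> \<le> q * ln (real n)} \<le> exp (- real n)"
    by (intro eventually_sequentiallyI[of 3])
  have "exp (- real n) = exp (-1) ^ n" for n
    by (simp add: exp_of_nat_mult[symmetric])
  then show "summable (\<lambda>n. exp (- real n))"
    by (simp add: summable_geometric)
  show "{\<omega> \<in> space P. \<forall>x\<in>{n + 2..n ^ p}. g x 1 \<omega> \<le> q * ln (real n)} \<in> events" for n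
    by measurable
qed

lemma front_weight_measurable [measurable]:
  "(\<lambda>\<omega>. front_weight l \<theta> n (path \<omega>) x) \<in> borel_measurable P"
  unfolding front_weight_def by measurable

text \<open>Iterates the supermartingale inequality from x = n + 1, where the weight is bounded
  outright because the front is required to be at most 2 log n.\<close>

lemma nn_integral_front_weight:
  assumes "0 < l" "exp (l * \<theta>) * (1 - exp (- \<theta>)) = 1" "n < x"
  shows "(\<integral>\<^sup>+ \<omega>. front_weight l \<theta> n (path \<omega>) x \<partial>P) \<le> ennreal (exp (l * (2 * ln (real n))))"
  using assms(3)
proof (induction x)
  case (Suc x)
  show ?case
  proof (cases "x = n")
    case True
    have "(\<integral>\<^sup>+ \<omega>. front_weight l \<theta> n (path \<omega>) (Suc n) \<partial>P) \<le> (\<integral>\<^sup>+ \<omega>. ennreal (exp (l * (2 * ln (real n)))) \<partial>P)"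
      using assms(1) by (intro nn_integral_mono) (auto simp: front_weight_def)
    then show ?thesis
      using True by (simp add: emeasure_space_1)
  next
    case False
    then have x: "n < x" using Suc.prems by simp
    have "(\<integral>\<^sup>+ \<omega>. front_weight l \<theta> n (path \<omega>) (Suc x) \<partial>P)
        = (\<integral>\<^sup>+ \<omega>. front_weight_step l \<theta> n x (path \<omega>) (g (Suc x) 1 \<omega>) \<partial>P)"
      by (intro nn_integral_cong_AE, use AE_fire_path in eventually_elim)
        (rule fire_path.front_weight_Suc[OF _ x])
    also have "\<dots> = (\<integral>\<^sup>+ \<omega>. (\<integral>\<^sup>+ u. front_weight_step l \<theta> n x (path \<omega>) u \<partial>Exp1) \<partial>P)"
    proof (rule nn_integral_first_wait)
      let ?M = "past_measure x \<Otimes>\<^sub>M borel :: ((nat \<times> nat \<Rightarrow> real) \<times> real) measure"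
      have burn_meas: "(\<lambda>p. burn \<theta> (\<lambda>y j. fst p (y, j)) y 1) \<in> borel_measurable ?M" if "y \<le> x" for y
        using that by (intro measurable_burn measurable_past) auto
      have [measurable]: "Measurable.pred ?M (\<lambda>p. \<forall>y\<in>{n<..<x}. \<not> record_site \<theta> (\<lambda>y j. fst p (y, j)) y)"
      proof (intro pred_intros_finite pred_intros_logic)
        fix y assume "y \<in> {n<..<x}"
        then show "Measurable.pred ?M (\<lambda>p. record_site \<theta> (\<lambda>y j. fst p (y, j)) y)"
          by (intro measurable_record_site measurable_past) auto
      qed simp
      have [measurable]: "(\<lambda>p. burn \<theta> (\<lambda>y j. fst p (y, j)) (Suc n) 1) \<in> borel_measurable ?M"
        "(\<lambda>p. burn \<theta> (\<lambda>y j. fst p (y, j)) x 1) \<in> borel_measurable ?M"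
        using x by (intro burn_meas; simp)+
      show "(\<lambda>p. front_weight_step l \<theta> n x (\<lambda>y j. fst p (y, j)) (snd p)) \<in> borel_measurable ?M"
        unfolding front_weight_step_def by measurable
    next
      fix f f' :: "nat \<Rightarrow> nat \<Rightarrow> real" and u
      assume eq: "\<And>y j. y \<le> x \<Longrightarrow> 1 \<le> j \<Longrightarrow> f y j = f' y j"
      have "burn \<theta> f y i = burn \<theta> f' y i" if "y \<le> x" for y i
        using that by (intro burn_cong eq) auto
      moreover have "record_site \<theta> f y = record_site \<theta> f' y" if "y \<in> {n<..<x}" for y
        using that by (intro record_site_cong eq) auto
      ultimately show "front_weight_step l \<theta> n x f u = front_weight_step l \<theta> n x f' u"
        using x by (simp add: front_weight_step_def)
    qed
    also have "\<dots> \<le> (\<integral>\<^sup>+ \<omega>. front_weight l \<theta> n (path \<omega>) x \<partial>P)"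
      by (intro nn_integral_mono_AE, use AE_fire_path in eventually_elim)
        (rule fire_path.integral_front_weight_step[OF _ assms(1,2)])
    finally show ?thesis
      using Suc.IH[OF x] by (rule order_trans)
  qed
qed simp

text \<open>Markov's inequality for the weight at n^p: the bound exp (-l q log n) exp (2 l log n)
  equals n^(-2) for q = 2 + 2 / l.\<close>

lemma AE_front_low:
  assumes l: "0 < l" "exp (l * \<theta>) * (1 - exp (- \<theta>)) = 1" and q: "q = 2 + 2 / l" and p: "2 \<le> p"
  shows "AE \<omega> in P. \<forall>\<^sub>F n in sequentially. \<not> (burn \<theta> (path \<omega>) (Suc n) 1 \<le> 2 * ln (real n) \<and>
     (\<forall>y\<in>{n<..<n ^ p}. \<not> record_site \<theta> (path \<omega>) y) \<and> q * ln (real n) < burn \<theta> (path \<omega>) (n ^ p) 1)"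
proof (rule AE_finitely_often)
  let ?Q = "\<lambda>n \<omega>. burn \<theta> (path \<omega>) (Suc n) 1 \<le> 2 * ln (real n) \<and>
     (\<forall>y\<in>{n<..<n ^ p}. \<not> record_site \<theta> (path \<omega>) y) \<and> q * ln (real n) < burn \<theta> (path \<omega>) (n ^ p) 1"
  show meas [measurable]: "{\<omega> \<in> space P. ?Q n \<omega>} \<in> events" for n
    by measurable
  show "\<forall>\<^sub>F n in sequentially. prob {\<omega> \<in> space P. ?Q n \<omega>} \<le> inverse (real n ^ 2)"
    using eventually_gt_at_top[of 1]
  proof eventually_elim
    case (elim n)
    have "n ^ 1 < n ^ p" using elim p by (intro power_strict_increasing) auto
    then have np: "n < n ^ p" by simp
    let ?c = "ennreal (exp (- (l * (q * ln (real n)))))"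
    have "emeasure P {\<omega> \<in> space P. ?Q n \<omega>} = (\<integral>\<^sup>+ \<omega>. indicator {\<omega> \<in> space P. ?Q n \<omega>} \<omega> \<partial>P)"
      by (rule nn_integral_indicator[OF meas, symmetric])
    also have "\<dots> \<le> (\<integral>\<^sup>+ \<omega>. ?c * front_weight l \<theta> n (path \<omega>) (n ^ p) \<partial>P)"
      using l(1) by (intro nn_integral_mono)
        (auto simp: front_weight_def indicator_def ennreal_mult[symmetric] exp_add[symmetric])
    also have "\<dots> = ?c * (\<integral>\<^sup>+ \<omega>. front_weight l \<theta> n (path \<omega>) (n ^ p) \<partial>P)"
      by (rule nn_integral_cmult) measurable
    also have "\<dots> \<le> ?c * ennreal (exp (l * (2 * ln (real n))))"
      by (intro mult_left_mono nn_integral_front_weight[OF l np]) simp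
    also have "\<dots> = ennreal (exp (- (2 * ln (real n))))"
      using l(1) by (simp add: ennreal_mult[symmetric] exp_add[symmetric] q field_simps)
    also have "\<dots> = ennreal (inverse (real n ^ 2))"
      using elim by (simp only: exp_minus_ln_nat)
    finally show ?case
      by (simp add: emeasure_eq_measure)
  qed
qed (simp add: inverse_power_summable)

lemma AE_first_burn_le_ln:
  assumes "0 \<le> c" and "AE \<omega> in P. \<forall>\<^sub>F n in sequentially. record_site \<theta> (path \<omega>) n \<longrightarrow>
    burn \<theta> (path \<omega>) n 2 \<le> c * ln (real n)"
  shows "\<exists>C>0. AE \<omega> in P. \<forall>\<^sub>F n in sequentially. burn \<theta> (path \<omega>) n 1 \<le> C * ln (real n)"
proof -
  \<comment> \<open>The solution of exp (l theta) (1 - exp (-theta)) = 1, positive since 0 < 1 - exp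
    (-theta) < 1.\<close>
  define l where "l = - ln (1 - exp (- \<theta>)) / \<theta>"
  have l: "0 < l" "exp (l * \<theta>) * (1 - exp (- \<theta>)) = 1"
    using theta_pos by (simp_all add: l_def exp_minus field_simps)
  define q where "q = 2 + 2 / l"
  define p where "p = nat \<lceil>q\<rceil> + 2"
  have q: "0 \<le> q" "q + 2 \<le> real p" "2 \<le> p"
    using l by (auto simp: q_def p_def)
  \<comment> \<open>At least 2 for the uniqueness of stalls, and at least c p for the contradiction
    at a record site before n^p.\<close>
  define C where "C = max 2 (c * real p)"
  have C: "2 \<le> C" "c * real p \<le> C" by (auto simp: C_def)
  have "c * 1 \<le> c * real p"
    using q assms(1) by (intro mult_left_mono) auto
  then have "c \<le> C" using C by simp
  have "AE \<omega> in P. \<forall>\<^sub>F n in sequentially. burn \<theta> (path \<omega>) n 1 \<le> C * ln (real n)"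
    using AE_fire_path AE_first_wait_le AE_first_wait_exceeds[OF q(1,2)]
      AE_front_low[OF l q_def q(3)] AE_late_tree_finitely_often[OF C(1)] assms(2)
  proof eventually_elim
    case (elim \<omega>)
    interpret fire_path \<theta> "path \<omega>" by (rule elim(1))
    show ?case
      using eventually_not_timely_tree[OF elim(3,4,6) assms(1) C(2)] elim(5)
      by (intro eventually_first_burn_le[OF elim(2,6) _ C(1) \<open>c \<le> C\<close>]) blast
  qed
  then show ?thesis
    using C by (intro exI[of _ C]) auto
qed

end

theorem theorem4p5:
  fixes P :: "'w measure"
    and \<theta> :: real
    and g :: "nat \<Rightarrow> nat \<Rightarrow> 'w \<Rightarrow> real"
  assumes "prob_space P"
    and "\<theta> > 0"
    and "prob_space.indep_vars P (\<lambda>_. borel) (\<lambda>(x, i). g x i) (UNIV \<times> {1..})"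
    and "\<And>x i. 1 \<le> i \<Longrightarrow> distributed P lborel (g x i) (exponential_density 1)"
    and "\<exists>c\<ge>1::real. AE \<omega> in P. \<exists>\<kappa>\<ge>1. \<forall>i\<ge>\<kappa>. \<forall>n.
           succ_max \<theta> (\<lambda>x j. g x j \<omega>) i = enat n \<longrightarrow>
           burn \<theta> (\<lambda>x j. g x j \<omega>) n 2 \<le> c * ln (real n)"
  shows "\<exists>M>0::real. AE \<omega> in P. \<forall>\<^sub>F n in sequentially.
           burn \<theta> (\<lambda>x j. g x j \<omega>) n 1 \<le> M * ln (real n)"
proof -
  interpret forest_fire P \<theta> g
    using assms(1-4) by (intro forest_fire.intro forest_fire_axioms.intro)
  obtain c where "1 \<le> c" and c: "AE \<omega> in P. \<exists>\<kappa>\<ge>1. \<forall>i\<ge>\<kappa>. \<forall>n.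
           succ_max \<theta> (path \<omega>) i = enat n \<longrightarrow> burn \<theta> (path \<omega>) n 2 \<le> c * ln (real n)"
    using assms(5) by blast
  have "AE \<omega> in P. \<forall>\<^sub>F n in sequentially. record_site \<theta> (path \<omega>) n \<longrightarrow>
    burn \<theta> (path \<omega>) n 2 \<le> c * ln (real n)"
    using c AE_fire_path
  proof eventually_elim
    case (elim \<omega>)
    then obtain \<kappa> where \<kappa>: "\<And>i n. \<kappa> \<le> i \<Longrightarrow> succ_max \<theta> (path \<omega>) i = enat n \<Longrightarrow>
        burn \<theta> (path \<omega>) n 2 \<le> c * ln (real n)"
      by blast
    from fire_path.eventually_record_succ_max[OF elim(2), of \<kappa>] show ?case
      by eventually_elim (use \<kappa> in blast)
  qed
  then show ?thesis
    using \<open>1 \<le> c\<close> by (intro AE_first_burn_le_ln[of c]) auto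
qed

end
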